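(* For every $n\ge1$, the $n$-dimensional hypercube $[-1,1]^n\subset\mathbb{R}^n$ is an $n$-brick.
   Context: $\overline{B}_m$ denotes the closed unit ball of $\mathbb{R}^m$ centered at the origin. An $n$-dimensional semialgebraic set $T\subset\mathbb{R}^n$ is an $m$-brick if there exists a homotopy $H=(H_1,\ldots,H_n):[0,1]\times\overline{B}_m\to T$ such that: (1) each $H_i$ is the restriction to $[0,1]\times\overline{B}_m$ of a polynomial of the ring $\mathcal{C}^0([0,1])[x_1,\ldots,x_m]$, where $\mathcal{C}^0([0,1])$ is the ring of continuous real functions on $[0,1]$; (2) $H(\{0\}\times\overline{B}_m)=T$ and $H(1,\cdot)$ is a constant map; (3) $H(\{t\}\times\overline{B}_m)\subset\operatorname{Int}(T)$ for each $t\in(0,1)$, where $\operatorname{Int}$ is the topological interior in $\mathbb{R}^n$. *)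

theory Defs
  imports "HOL-Analysis.Analysis"
begin

text \<open>The semialgebraic subsets of \<open>\<real>\<^sup>n\<close>: the Boolean algebra generated by the sets
  \<open>{p > 0}\<close>.\<close>

inductive semialgebraic :: "'a::euclidean_space set \<Rightarrow> bool" where
  semialgebraic_pos: "real_polynomial_function p \<Longrightarrow> semialgebraic {x. 0 < p x}"
| semialgebraic_Compl: "semialgebraic S \<Longrightarrow> semialgebraic (- S)"
| semialgebraic_Un: "semialgebraic S \<Longrightarrow> semialgebraic T \<Longrightarrow> semialgebraic (S \<union> T)"
| semialgebraic_Int: "semialgebraic S \<Longrightarrow> semialgebraic T \<Longrightarrow> semialgebraic (S \<inter> T)"

text \<open>A real function on \<open>C\<close> is semialgebraic if its graph is.\<close>

definition semialgebraic_function_on :: "'a::euclidean_space set \<Rightarrow> ('a \<Rightarrow> real) \<Rightarrow> bool" where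
  "semialgebraic_function_on C f \<longleftrightarrow> semialgebraic ((\<lambda>x. (x, f x)) ` C)"

text \<open>\<open>C\<close> is semialgebraically homeomorphic to \<open>(0,1)\<^sup>d\<close>. The open cube is the product space
  indexed by \<open>{..<d}\<close>, so that \<open>d\<close> is an arbitrary natural number; a map into it is semialgebraic
  if and only if each of its components is.\<close>

definition semialgebraic_open_cell :: "nat \<Rightarrow> 'a::euclidean_space set \<Rightarrow> bool" where
  "semialgebraic_open_cell d C \<longleftrightarrow>
     semialgebraic C \<and>
     (\<exists>\<phi> :: 'a \<Rightarrow> nat \<Rightarrow> real.
        (\<forall>i<d. semialgebraic_function_on C (\<lambda>x. \<phi> x i)) \<and>
        homeomorphic_map (top_of_set C)
          (product_topology (\<lambda>i. top_of_set {0<..<1::real}) {..<d}) \<phi>)"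

text \<open>\<open>T\<close> has dimension \<open>d\<close>: \<open>d\<close> is the largest number such that \<open>T\<close> contains a semialgebraic
  set semialgebraically homeomorphic to \<open>(0,1)\<^sup>d\<close>. It is a relation, so no junk value arises for
  the empty set.\<close>

definition has_semialgebraic_dim :: "'a::euclidean_space set \<Rightarrow> nat \<Rightarrow> bool" where
  "has_semialgebraic_dim T d \<longleftrightarrow>
     (\<exists>C\<subseteq>T. semialgebraic_open_cell d C) \<and>
     (\<forall>e. (\<exists>C\<subseteq>T. semialgebraic_open_cell e C) \<longrightarrow> e \<le> d)"

text \<open>\<open>f\<close> agrees on \<open>[0,1] \<times> X\<close> with a polynomial of \<open>C\<^sup>0([0,1])[x\<^sub>1,\<dots>,x\<^sub>m]\<close>, where \<open>A\<close> is a finite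
  set of exponent vectors.\<close>

definition polynomial_over_C0_on ::
    "(real ^ 'm) set \<Rightarrow> (real \<times> (real ^ 'm) \<Rightarrow> real) \<Rightarrow> bool" where
  "polynomial_over_C0_on X f \<longleftrightarrow>
     (\<exists>(A :: ('m \<Rightarrow> nat) set) c.
        finite A \<and>
        (\<forall>\<alpha>\<in>A. continuous_on {0..1::real} (c \<alpha>)) \<and>
        (\<forall>t\<in>{0..1}. \<forall>x\<in>X. f (t, x) = (\<Sum>\<alpha>\<in>A. c \<alpha> t * (\<Prod>j\<in>UNIV. x $ j ^ \<alpha> j))))"

text \<open>An \<open>m\<close>-brick in \<open>\<real>\<^sup>n\<close>, where \<open>m = CARD('m) \<ge> 1\<close> and \<open>n = CARD('n)\<close>; \<open>cball 0 1\<close> is the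
  Euclidean closed unit ball of \<open>\<real>\<^sup>m\<close>.\<close>

definition brick :: "'m::finite itself \<Rightarrow> (real ^ 'n) set \<Rightarrow> bool" where
  "brick _ T \<longleftrightarrow>
     semialgebraic T \<and> has_semialgebraic_dim T CARD('n) \<and>
     (\<exists>H :: real \<times> (real ^ 'm) \<Rightarrow> real ^ 'n.
        continuous_on ({0..1} \<times> cball 0 1) H \<and>
        H ` ({0..1} \<times> cball 0 1) \<subseteq> T \<and>
        (\<forall>i. polynomial_over_C0_on (cball 0 1) (\<lambda>p. H p $ i)) \<and>
        H ` ({0} \<times> cball 0 1) = T \<and>
        (\<exists>a. \<forall>x\<in>cball 0 1. H (1, x) = a) \<and>
        (\<forall>t\<in>{0<..<1}. H ` ({t} \<times> cball 0 1) \<subseteq> interior T))"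

end

theory Submission imports Defs begin

text \<open>
  A polynomial map \<open>f\<close> of \<open>\<real>\<^sup>n\<close> that carries the closed unit ball onto the cube \<open>Q = [-1,1]\<^sup>n\<close>
  makes \<open>Q\<close> a brick: \<open>H (t, x) = (1 - t) f x\<close> shrinks \<open>Q\<close> to its centre, and since the cube
  is convex and symmetric, \<open>(1 - t) Q\<close> is interior to \<open>Q\<close> as soon as \<open>0 < t\<close>.

  Such an \<open>f\<close> applies one Chebyshev polynomial \<open>T\<^sub>k\<close> to every coordinate. The ball lies
  in \<open>Q\<close>, and \<open>T\<^sub>k\<close> maps \<open>[-1,1]\<close> into itself, so \<open>f\<close> maps the ball into \<open>Q\<close>. Conversely the
  ball contains the small cube \<open>[-1/n, 1/n]\<^sup>n\<close>. For large \<open>k\<close> the polynomial \<open>T\<^sub>k\<close> oscillates so fast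
  that it takes all values in \<open>[-1,1]\<close> already on \<open>[-1/n, 1/n]\<close>; thus \<open>f\<close> maps the
  small cube, and hence the ball, onto \<open>Q\<close>. The choice \<open>k = 4 n\<close> is enough.

  That \<open>Q\<close> has dimension \<open>n\<close> has two sides. A box is an open cell of full dimension, by an
  affine change of coordinates. And a cell of dimension larger than \<open>n\<close> would contain an injective
  continuous image of an open subset of \<open>\<real>\<^sup>n \<times> \<real>\<close> inside \<open>\<real>\<^sup>n\<close>, which invariance of dimension
  excludes.
\<close>

section \<open>Semialgebraic sets\<close>

lemma semialgebraic_le:
  assumes "real_polynomial_function p"
  shows "semialgebraic {x. p x \<le> 0}"
proof -
  have "{x. p x \<le> 0} = - {x. 0 < p x}" by auto
  with assms show ?thesis by (simp add: semialgebraic_pos semialgebraic_Compl)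
qed

lemma semialgebraic_eq:
  assumes "real_polynomial_function p"
  shows "semialgebraic {x. p x = 0}"
proof -
  have "real_polynomial_function (\<lambda>x. - 1 * p x)"
    by (intro real_polynomial_function.intros(2,4) assms)
  then have "semialgebraic ({x. p x \<le> 0} \<inter> {x. - 1 * p x \<le> 0})"
    using assms by (intro semialgebraic_Int semialgebraic_le)
  moreover have "{x. p x = 0} = {x. p x \<le> 0} \<inter> {x. - 1 * p x \<le> 0}" by auto
  ultimately show ?thesis by simp
qed

lemma semialgebraic_UNIV: "semialgebraic (UNIV :: 'a::euclidean_space set)"
proof -
  have "semialgebraic {x :: 'a. 0 < (1::real)}"
    by (rule semialgebraic_pos) blast
  then show ?thesis by simp
qed

lemma semialgebraic_INT:
  assumes "finite I" "\<And>i. i \<in> I \<Longrightarrow> semialgebraic (S i)"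
  shows "semialgebraic (\<Inter>i\<in>I. S i)"
  using assms by (induction I) (auto intro: semialgebraic_UNIV semialgebraic_Int)

text \<open>The box is pulled back along a linear map so that the lemma also covers cylinders over
  boxes, which occur in graphs of functions.\<close>

lemma semialgebraic_linear_preimage_box:
  fixes h :: "'b::euclidean_space \<Rightarrow> 'a::euclidean_space"
  assumes "bounded_linear h"
  shows "semialgebraic {x. h x \<in> box l u}"
proof -
  have lin: "real_polynomial_function (\<lambda>x. h x \<bullet> i)" for i
    using bounded_linear_compose[OF bounded_linear_inner_left assms]
    by (rule real_polynomial_function.intros(1))
  have "real_polynomial_function (\<lambda>x. h x \<bullet> i + - (l \<bullet> i))"
    and "real_polynomial_function (\<lambda>x. u \<bullet> i + - 1 * (h x \<bullet> i))" for i
    by (intro real_polynomial_function.intros(2-4) lin)+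
  then have "semialgebraic (\<Inter>i\<in>Basis. {x. 0 < h x \<bullet> i + - (l \<bullet> i)} \<inter> {x. 0 < u \<bullet> i + - 1 * (h x \<bullet> i)})"
    by (intro semialgebraic_INT semialgebraic_Int semialgebraic_pos) auto
  moreover have "{x. h x \<in> box l u}
      = (\<Inter>i\<in>Basis. {x. 0 < h x \<bullet> i + - (l \<bullet> i)} \<inter> {x. 0 < u \<bullet> i + - 1 * (h x \<bullet> i)})"
    by (auto simp: box_def)
  ultimately show ?thesis by simp
qed

lemma semialgebraic_cbox:
  fixes l u :: "'a::euclidean_space"
  shows "semialgebraic (cbox l u)"
proof -
  have lin: "real_polynomial_function (\<lambda>x. x \<bullet> i)" for i :: 'a
    using bounded_linear_inner_left by (rule real_polynomial_function.intros(1))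
  have "real_polynomial_function (\<lambda>x. l \<bullet> i + - 1 * (x \<bullet> i))"
    and "real_polynomial_function (\<lambda>x. x \<bullet> i + - (u \<bullet> i))" for i :: 'a
    by (intro real_polynomial_function.intros(2-4) lin)+
  then have "semialgebraic (\<Inter>i\<in>Basis. {x. l \<bullet> i + - 1 * (x \<bullet> i) \<le> 0} \<inter> {x. x \<bullet> i + - (u \<bullet> i) \<le> 0})"
    by (intro semialgebraic_INT semialgebraic_Int semialgebraic_le) auto
  moreover have "cbox l u
      = (\<Inter>i\<in>Basis. {x. l \<bullet> i + - 1 * (x \<bullet> i) \<le> 0} \<inter> {x. x \<bullet> i + - (u \<bullet> i) \<le> 0})"
    by (auto simp: cbox_def)
  ultimately show ?thesis by simp
qed

section \<open>Dimension\<close>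

lemma ex_Basis_enumeration:
  obtains b :: "nat \<Rightarrow> 'a::euclidean_space" where "bij_betw b {..<DIM('a)} Basis"
  using ex_bij_betw_nat_finite[OF finite_Basis] by (auto simp: atLeast0LessThan)

lemma inner_Basis_enumeration:
  fixes b :: "nat \<Rightarrow> 'a::euclidean_space"
  assumes b: "bij_betw b {..<DIM('a)} Basis" and "i < DIM('a)" "j < DIM('a)"
  shows "b i \<bullet> b j = (if i = j then 1 else 0)"
proof -
  have "b i \<in> Basis" "b j \<in> Basis" "b i = b j \<longleftrightarrow> i = j"
    using assms by (auto simp: bij_betw_def inj_on_eq_iff)
  then show ?thesis by (simp add: inner_Basis)
qed

lemma euclidean_eqI_enumeration:
  fixes b :: "nat \<Rightarrow> 'a::euclidean_space"
  assumes "bij_betw b {..<DIM('a)} Basis" and "\<And>i. i < DIM('a) \<Longrightarrow> x \<bullet> b i = y \<bullet> b i"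
  shows "x = y"
proof (rule euclidean_eqI)
  fix c :: 'a assume "c \<in> Basis"
  then obtain i where "i < DIM('a)" "c = b i"
    using assms(1) by (auto simp: bij_betw_def)
  then show "x \<bullet> c = y \<bullet> c" using assms(2) by simp
qed

text \<open>The affine map that sends each edge of the box to \<open>(0,1)\<close> identifies the box with the open
  cube.\<close>

lemma semialgebraic_open_cell_box:
  fixes l u :: "'a::euclidean_space"
  assumes ne: "box l u \<noteq> {}"
  shows "semialgebraic_open_cell DIM('a) (box l u)"
proof -
  obtain b :: "nat \<Rightarrow> 'a" where b: "bij_betw b {..<DIM('a)} Basis"
    by (rule ex_Basis_enumeration)
  have bB: "b i \<in> Basis" if "i < DIM('a)" for i
    using b that by (auto simp: bij_betw_def)
  define w where "w i = u \<bullet> b i - l \<bullet> b i" for i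
  have w: "0 < w i" if "i < DIM('a)" for i
    using ne bB[OF that] by (auto simp: w_def box_ne_empty)
  \<comment> \<open>Points of the product space are extensional functions, so the coordinates beyond the
    dimension have to be \<open>undefined\<close>.\<close>
  define \<phi> where "\<phi> x i = (if i < DIM('a) then (x \<bullet> b i - l \<bullet> b i) / w i else undefined)" for x i
  define \<psi> where "\<psi> g = (\<Sum>i<DIM('a). (l \<bullet> b i + g i * w i) *\<^sub>R b i)" for g
  let ?P = "product_topology (\<lambda>i. top_of_set {0<..<1::real}) {..<DIM('a)}"
  have \<psi>_inner: "\<psi> g \<bullet> b j = l \<bullet> b j + g j * w j" if "j < DIM('a)" for g j
  proof -
    have "\<psi> g \<bullet> b j = (\<Sum>i<DIM('a). (l \<bullet> b i + g i * w i) * (b i \<bullet> b j))"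
      by (simp add: \<psi>_def inner_sum_left)
    also have "\<dots> = (\<Sum>i<DIM('a). if i = j then l \<bullet> b i + g i * w i else 0)"
      using that by (intro sum.cong) (auto simp: inner_Basis_enumeration[OF b])
    finally show ?thesis using that by simp
  qed
  have mem_box_b: "x \<in> box l u \<longleftrightarrow> (\<forall>i<DIM('a). l \<bullet> b i < x \<bullet> b i \<and> x \<bullet> b i < u \<bullet> b i)" for x
  proof -
    have "x \<in> box l u \<longleftrightarrow> (\<forall>c\<in>b ` {..<DIM('a)}. l \<bullet> c < x \<bullet> c \<and> x \<bullet> c < u \<bullet> c)"
      unfolding bij_betw_imp_surj_on[OF b] by (simp add: box_def)
    then show ?thesis by auto
  qed
  have "homeomorphic_maps (top_of_set (box l u)) ?P \<phi> \<psi>"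
    unfolding homeomorphic_maps_def
  proof (intro conjI ballI)
    show "continuous_map (top_of_set (box l u)) ?P \<phi>"
    proof (rule continuous_map_coordinatewise_then_product)
      fix i assume "i \<in> {..<DIM('a)}"
      then have i: "i < DIM('a)" by simp
      have "continuous_on (box l u) (\<lambda>x. (x \<bullet> b i - l \<bullet> b i) / w i)"
        using w[OF i] by (intro continuous_intros) auto
      moreover have "(x \<bullet> b i - l \<bullet> b i) / w i \<in> {0<..<1}" if "x \<in> box l u" for x
        using that i w[OF i] by (auto simp: mem_box_b w_def field_simps)
      ultimately show "continuous_map (top_of_set (box l u)) (top_of_set {0<..<1}) (\<lambda>x. \<phi> x i)"
        using i by (auto simp: \<phi>_def)
    qed (auto simp: \<phi>_def)
  next
    have "continuous_map ?P euclideanreal (\<lambda>g. g i)" if "i < DIM('a)" for i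
      using continuous_map_product_projection[of i "{..<DIM('a)}" "\<lambda>i. top_of_set {0<..<1::real}"] that
      by (auto intro: continuous_map_into_fulltopology)
    then have "continuous_map ?P euclidean \<psi>"
      unfolding \<psi>_def by (simp add: continuous_map_atin) (auto intro!: tendsto_intros)
    moreover have "\<psi> g \<in> box l u" if "g \<in> topspace ?P" for g
    proof -
      have g: "0 < g i" "g i < 1" if "i < DIM('a)" for i
        using \<open>g \<in> topspace ?P\<close> that by (auto simp: PiE_iff)
      have "0 < g i * w i" "g i * w i < w i" if "i < DIM('a)" for i
        using g[OF that] w[OF that] by auto
      then show ?thesis by (force simp: mem_box_b \<psi>_inner w_def)
    qed
    ultimately show "continuous_map ?P (top_of_set (box l u)) \<psi>"
      by (auto simp: continuous_map_in_subtopology)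
  next
    fix x assume "x \<in> topspace (top_of_set (box l u))"
    show "\<psi> (\<phi> x) = x"
    proof (rule euclidean_eqI_enumeration[OF b])
      fix i assume "i < DIM('a)"
      then show "\<psi> (\<phi> x) \<bullet> b i = x \<bullet> b i"
        using w[of i] by (simp add: \<psi>_inner \<phi>_def)
    qed
  next
    fix g assume g: "g \<in> topspace ?P"
    show "\<phi> (\<psi> g) = g"
    proof
      fix i
      show "\<phi> (\<psi> g) i = g i"
        using g w[of i] by (auto simp: \<phi>_def \<psi>_inner PiE_iff extensional_def)
    qed
  qed
  then have "homeomorphic_map (top_of_set (box l u)) ?P \<phi>"
    by (auto simp: homeomorphic_map_maps)
  moreover have "semialgebraic_function_on (box l u) (\<lambda>x. \<phi> x i)" if i: "i < DIM('a)" for i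
  proof -
    have "bounded_linear (\<lambda>z :: 'a \<times> real. fst z \<bullet> b i)"
      by (intro bounded_linear_intros)
    then have fst: "real_polynomial_function (\<lambda>z :: 'a \<times> real. fst z \<bullet> b i)"
      by (rule real_polynomial_function.intros(1))
    have snd: "real_polynomial_function (snd :: 'a \<times> real \<Rightarrow> real)"
      using bounded_linear_snd by (rule real_polynomial_function.intros(1))
    have "real_polynomial_function
        (\<lambda>z :: 'a \<times> real. (fst z \<bullet> b i + - (l \<bullet> b i)) + - w i * snd z)"
      by (intro real_polynomial_function.intros(2-4) fst snd)
    then have "semialgebraic ({z :: 'a \<times> real. fst z \<in> box l u}
        \<inter> {z. (fst z \<bullet> b i + - (l \<bullet> b i)) + - w i * snd z = 0})"
      by (intro semialgebraic_Int semialgebraic_eq semialgebraic_linear_preimage_box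
          bounded_linear_fst)
    moreover have "(\<lambda>x. (x, \<phi> x i)) ` box l u = {z :: 'a \<times> real. fst z \<in> box l u}
        \<inter> {z. (fst z \<bullet> b i + - (l \<bullet> b i)) + - w i * snd z = 0}"
      using i w[OF i] by (auto simp: \<phi>_def field_simps image_iff)
    ultimately show ?thesis by (simp add: semialgebraic_function_on_def)
  qed
  moreover have "semialgebraic (box l u)"
    using semialgebraic_linear_preimage_box[OF bounded_linear_ident, of l u] by simp
  ultimately show ?thesis
    unfolding semialgebraic_open_cell_def by blast
qed

text \<open>If \<open>d\<close> exceeded the dimension of the space \<open>'a\<close>, then \<open>(0,1)\<^sup>d\<close> would contain a copy of the
  open unit cube of \<open>'a \<times> real\<close>, and the chart of the cell would embed that cube into \<open>'a\<close>, against
  invariance of dimension.\<close>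

lemma semialgebraic_open_cell_le_DIM:
  fixes C :: "'a::euclidean_space set"
  assumes "semialgebraic_open_cell d C"
  shows "d \<le> DIM('a)"
proof (rule ccontr)
  assume "\<not> d \<le> DIM('a)"
  then have d: "DIM('a) < d" by simp
  let ?P = "product_topology (\<lambda>i. top_of_set {0<..<1::real}) {..<d}"
  obtain \<phi> \<psi> where "homeomorphic_maps (top_of_set C) ?P \<phi> \<psi>"
    using assms unfolding semialgebraic_open_cell_def homeomorphic_map_maps by blast
  then have \<psi>: "continuous_map ?P (top_of_set C) \<psi>" "\<And>g. g \<in> topspace ?P \<Longrightarrow> \<phi> (\<psi> g) = g"
    by (auto simp: homeomorphic_maps_def)
  obtain b :: "nat \<Rightarrow> 'a" where b: "bij_betw b {..<DIM('a)} Basis"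
    by (rule ex_Basis_enumeration)
  have bB: "b i \<in> Basis" if "i < DIM('a)" for i
    using b that by (auto simp: bij_betw_def)
  define U :: "('a \<times> real) set" where "U = box 0 One \<times> {0<..<1}"
  define j :: "'a \<times> real \<Rightarrow> nat \<Rightarrow> real" where
    "j z i = (if i < DIM('a) then fst z \<bullet> b i else if i = DIM('a) then snd z
              else if i < d then 1/2 else undefined)" for z i
  have j: "continuous_map (top_of_set U) ?P j"
  proof (rule continuous_map_coordinatewise_then_product)
    fix i assume i: "i \<in> {..<d}"
    have "continuous_on U (\<lambda>z. j z i)"
      using i unfolding j_def
      by (cases "i < DIM('a)"; cases "i = DIM('a)") (auto intro!: continuous_intros)
    moreover have "j z i \<in> {0<..<1}" if "z \<in> U" for z
      using i that bB[of i] by (auto simp: j_def U_def box_def)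
    ultimately show "continuous_map (top_of_set U) (top_of_set {0<..<1}) (\<lambda>z. j z i)"
      by auto
  qed (use d in \<open>auto simp: j_def\<close>)
  have "continuous_map (top_of_set U) (top_of_set C) (\<psi> \<circ> j)"
    using j \<psi>(1) by (rule continuous_map_compose)
  then have "continuous_on U (\<psi> \<circ> j)"
    by simp
  moreover have "inj_on (\<psi> \<circ> j) U"
  proof (rule comp_inj_on)
    show "inj_on j U"
    proof (rule inj_onI, rule prod_eqI)
      fix y z assume "j y = j z"
      then have eq: "j y i = j z i" for i by simp
      show "fst y = fst z"
      proof (rule euclidean_eqI_enumeration[OF b])
        fix i assume "i < DIM('a)"
        then show "fst y \<bullet> b i = fst z \<bullet> b i"
          using eq[of i] by (simp add: j_def)
      qed
      show "snd y = snd z"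
        using eq[of "DIM('a)"] by (simp add: j_def)
    qed
    have "j ` U \<subseteq> topspace ?P"
      using continuous_map_image_subset_topspace[OF j] by simp
    then show "inj_on \<psi> (j ` U)"
      using \<psi>(2) by (intro inj_on_inverseI[where g = \<phi>]) blast
  qed
  moreover have "open U"
    unfolding U_def by (intro open_Times open_box open_greaterThanLessThan)
  moreover have "U \<noteq> {}"
    by (auto simp: U_def box_ne_empty)
  ultimately have "DIM('a \<times> real) \<le> DIM('a)"
    by (intro invariance_of_dimension)
  then show False by simp
qed

lemma has_semialgebraic_dim_box_subset:
  fixes T :: "'a::euclidean_space set"
  assumes "box l u \<subseteq> T" "box l u \<noteq> {}"
  shows "has_semialgebraic_dim T DIM('a)"
  unfolding has_semialgebraic_dim_def
  using assms semialgebraic_open_cell_box semialgebraic_open_cell_le_DIM by blast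

section \<open>Chebyshev polynomials\<close>

fun chebyshev_poly :: "nat \<Rightarrow> real poly" where
  "chebyshev_poly 0 = 1"
| "chebyshev_poly (Suc 0) = [:0, 1:]"
| "chebyshev_poly (Suc (Suc k)) = [:0, 2:] * chebyshev_poly (Suc k) - chebyshev_poly k"

lemma poly_chebyshev_cos: "poly (chebyshev_poly k) (cos \<theta>) = cos (real k * \<theta>)"
proof (induction k rule: chebyshev_poly.induct)
  case (3 k)
  have "cos (real (Suc (Suc k)) * \<theta>) = cos (real (Suc k) * \<theta> + \<theta>)"
    and "cos (real k * \<theta>) = cos (real (Suc k) * \<theta> - \<theta>)"
    by (simp_all add: algebra_simps)
  then have "cos (real (Suc (Suc k)) * \<theta>) = 2 * cos \<theta> * cos (real (Suc k) * \<theta>) - cos (real k * \<theta>)"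
    unfolding cos_add cos_diff by simp
  with 3 show ?case by simp
qed auto

lemma abs_poly_chebyshev_le_1:
  assumes "\<bar>x\<bar> \<le> 1"
  shows "\<bar>poly (chebyshev_poly k) x\<bar> \<le> 1"
proof -
  have "x = cos (arccos x)"
    using assms by (simp add: cos_arccos_abs)
  then show ?thesis
    by (metis poly_chebyshev_cos abs_cos_le_one)
qed

text \<open>Near \<open>0 = cos (pi/2)\<close> the polynomial of degree \<open>4 n\<close> runs through a half period while the
  angle moves from \<open>pi/2\<close> to \<open>pi/2 + pi/(4 n)\<close>, and this changes the cosine by at most
  \<open>pi/(4 n) \<le> 1/n\<close>. The factor 4 moreover makes \<open>4 n * pi/2\<close> a multiple of the period, so that the
  half period starts at the value 1.\<close>

lemma chebyshev_surj_near_0: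
  assumes n: "0 < n" and y: "\<bar>y\<bar> \<le> 1"
  obtains x where "\<bar>x\<bar> \<le> 1 / real n" "poly (chebyshev_poly (4 * n)) x = y"
proof
  define \<alpha> where "\<alpha> = arccos y / (4 * real n)"
  have "0 \<le> arccos y" "arccos y \<le> pi"
    using y by (auto intro: arccos_lbound arccos_ubound)
  then have "\<bar>\<alpha>\<bar> \<le> 1 / real n"
    using n pi_less_4 by (auto simp: \<alpha>_def field_simps)
  moreover have "cos (pi/2 + \<alpha>) = - sin \<alpha>"
    by (simp add: cos_add)
  ultimately show "\<bar>cos (pi/2 + \<alpha>)\<bar> \<le> 1 / real n"
    using abs_sin_x_le_abs_x[of \<alpha>] by simp
  have "real (4 * n) * (pi/2 + \<alpha>) = arccos y + 2 * real n * pi"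
    using n by (simp add: \<alpha>_def field_simps)
  then have "poly (chebyshev_poly (4 * n)) (cos (pi/2 + \<alpha>)) = cos (arccos y + 2 * real n * pi)"
    by (simp only: poly_chebyshev_cos)
  also have "\<dots> = y"
    using y by (simp add: cos_add cos_arccos_abs)
  finally show "poly (chebyshev_poly (4 * n)) (cos (pi/2 + \<alpha>)) = y" .
qed

section \<open>The cube as a polynomial image of the ball\<close>

abbreviation chebyshev_map :: "real ^ 'n::finite \<Rightarrow> real ^ 'n" where
  "chebyshev_map x \<equiv> (\<chi> i. poly (chebyshev_poly (4 * CARD('n))) (x $ i))"

lemma chebyshev_map_image_cball:
  "chebyshev_map ` cball 0 1 = {x :: real ^ 'n::finite. \<forall>i. -1 \<le> x $ i \<and> x $ i \<le> 1}"
proof (intro subset_antisym subsetI)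
  fix y :: "real ^ 'n" assume "y \<in> chebyshev_map ` cball 0 1"
  then obtain x :: "real ^ 'n" where x: "norm x \<le> 1" "y = chebyshev_map x"
    by auto
  have "\<bar>x $ i\<bar> \<le> 1" for i
    using component_le_norm_cart[of x i] x(1) by linarith
  then have "\<bar>y $ i\<bar> \<le> 1" for i
    unfolding x(2) by (simp add: abs_poly_chebyshev_le_1)
  then show "y \<in> {x. \<forall>i. -1 \<le> x $ i \<and> x $ i \<le> 1}"
    by (simp add: abs_le_iff minus_le_iff)
next
  fix y :: "real ^ 'n" assume "y \<in> {x. \<forall>i. -1 \<le> x $ i \<and> x $ i \<le> 1}"
  then have "\<bar>y $ i\<bar> \<le> 1" for i by (simp add: abs_le_iff minus_le_iff)
  then have "\<exists>x. \<bar>x\<bar> \<le> 1 / real CARD('n) \<and> poly (chebyshev_poly (4 * CARD('n))) x = y $ i" for i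
    by (metis chebyshev_surj_near_0 zero_less_card_finite)
  then obtain x where x: "\<And>i. \<bar>x i\<bar> \<le> 1 / real CARD('n)"
      "\<And>i. poly (chebyshev_poly (4 * CARD('n))) (x i) = y $ i"
    by metis
  have "norm (\<chi> i. x i) \<le> (\<Sum>i\<in>UNIV. \<bar>x i\<bar>)"
    using norm_le_l1_cart[of "\<chi> i. x i"] by simp
  also have "\<dots> \<le> (\<Sum>i\<in>(UNIV :: 'n set). 1 / real CARD('n))"
    by (intro sum_mono x)
  also have "\<dots> = 1" by simp
  finally have "(\<chi> i. x i) \<in> cball 0 1" by simp
  moreover have "y = chebyshev_map (\<chi> i. x i)"
    by (simp add: x(2) vec_eq_iff)
  ultimately show "y \<in> chebyshev_map ` cball 0 1" by blast
qed

text \<open>The exponent vectors that occur are the multiples of the \<open>i\<close>-th unit vector; such a vector is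
  determined by its \<open>i\<close>-th entry, which also picks the coefficient.\<close>

lemma polynomial_over_C0_on_coordinate_poly:
  fixes i :: "'m::finite" and p :: "real poly"
  assumes "continuous_on {0..1} a"
  shows "polynomial_over_C0_on X (\<lambda>z. a (fst z) * poly p (snd z $ i))"
  unfolding polynomial_over_C0_on_def
proof (intro exI conjI ballI)
  define e where "e k = (\<lambda>j :: 'm. if j = i then k else 0 :: nat)" for k
  have inj: "inj e"
    by (rule inj_on_inverseI[where g = "\<lambda>\<alpha>. \<alpha> i"]) (simp add: e_def)
  show "finite (e ` {..degree p})" by simp
  show "continuous_on {0..1} (\<lambda>t. a t * coeff p (\<alpha> i))" for \<alpha>
    by (intro continuous_intros assms)
  fix t :: real and x :: "real ^ 'm"
  have monomial: "(\<Prod>j\<in>UNIV. x $ j ^ e k j) = x $ i ^ k" for k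
  proof -
    have "(\<Prod>j\<in>UNIV. x $ j ^ e k j) = (\<Prod>j\<in>UNIV. if j = i then x $ j ^ k else 1)"
      by (intro prod.cong) (auto simp: e_def)
    then show ?thesis by simp
  qed
  have "(\<Sum>\<alpha>\<in>e ` {..degree p}. a t * coeff p (\<alpha> i) * (\<Prod>j\<in>UNIV. x $ j ^ \<alpha> j))
      = (\<Sum>k\<le>degree p. a t * coeff p (e k i) * (\<Prod>j\<in>UNIV. x $ j ^ e k j))"
    using inj by (subst sum.reindex) (auto simp: inj_on_def)
  also have "\<dots> = a t * poly p (x $ i)"
    by (simp add: monomial poly_altdef sum_distrib_left mult.assoc) (simp add: e_def)
  finally show "a (fst (t, x)) * poly p (snd (t, x) $ i)
      = (\<Sum>\<alpha>\<in>e ` {..degree p}. a t * coeff p (\<alpha> i) * (\<Prod>j\<in>UNIV. x $ j ^ \<alpha> j))"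
    by simp
qed

theorem corollary2p9:
  shows "brick TYPE('n::finite) {x :: real ^ 'n. \<forall>i. -1 \<le> x $ i \<and> x $ i \<le> 1}"
proof -
  let ?Q = "{x :: real ^ 'n. \<forall>i. -1 \<le> x $ i \<and> x $ i \<le> 1}"
  have Q: "?Q = cbox (-1) 1"
    by (auto simp: mem_box_cart)
  have Q_abs: "x \<in> ?Q \<longleftrightarrow> (\<forall>i. \<bar>x $ i\<bar> \<le> 1)" for x
    by (auto simp: abs_le_iff minus_le_iff)
  have box_ne: "box (-1) 1 \<noteq> ({} :: (real ^ 'n) set)"
    by (auto simp: mem_box_cart intro!: exI[of _ 0] simp flip: ex_in_conv)
  have "has_semialgebraic_dim ?Q CARD('n)"
    using has_semialgebraic_dim_box_subset[OF _ box_ne, of ?Q] box_subset_cbox[of "-1" "1 :: real ^ 'n"]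
    unfolding Q by simp
  moreover have "semialgebraic ?Q"
    unfolding Q by (rule semialgebraic_cbox)
  moreover define H :: "real \<times> (real ^ 'n) \<Rightarrow> real ^ 'n" where
    "H z = (1 - fst z) *\<^sub>R chebyshev_map (snd z)" for z
  have "continuous_on ({0..1} \<times> cball 0 1) H"
    unfolding H_def by (intro continuous_intros)
  moreover have mem_Q: "chebyshev_map x \<in> ?Q" if "x \<in> cball 0 1" for x :: "real ^ 'n"
    using that chebyshev_map_image_cball by blast
  have "H ` ({0..1} \<times> cball 0 1) \<subseteq> ?Q"
  proof (rule image_subsetI)
    fix z :: "real \<times> (real ^ 'n)" assume "z \<in> {0..1} \<times> cball 0 1"
    moreover obtain t x where z: "z = (t, x)" by fastforce
    ultimately have "\<bar>H (t, x) $ i\<bar> \<le> 1" for i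
      using mem_Q[of x] unfolding Q_abs
      by (auto simp: H_def abs_mult intro!: mult_le_one)
    then show "H z \<in> ?Q"
      unfolding z Q_abs by blast
  qed
  moreover have "polynomial_over_C0_on (cball 0 1) (\<lambda>z. H z $ i)" for i
    unfolding H_def
    using polynomial_over_C0_on_coordinate_poly[of "\<lambda>t. 1 - t" "cball 0 1"
        "chebyshev_poly (4 * CARD('n))" i]
    by (simp add: continuous_intros)
  moreover have "H ` ({0} \<times> cball 0 1) = ?Q"
  proof -
    have "H ` ({0} \<times> cball 0 1) = chebyshev_map ` cball 0 1"
      by (force simp: H_def)
    then show ?thesis by (simp only: chebyshev_map_image_cball)
  qed
  moreover have "\<exists>a. \<forall>x\<in>cball 0 1. H (1, x) = a"
    by (simp add: H_def)
  moreover have "H ` ({t} \<times> cball 0 1) \<subseteq> interior ?Q" if t: "t \<in> {0<..<1}" for t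
  proof clarify
    fix x :: "real ^ 'n" assume x: "x \<in> cball 0 1"
    have "\<bar>H (t, x) $ i\<bar> < 1" for i
    proof -
      have "\<bar>H (t, x) $ i\<bar> = (1 - t) * \<bar>chebyshev_map x $ i\<bar>"
        using t by (simp add: H_def abs_mult)
      also have "\<dots> \<le> (1 - t) * 1"
        using t mem_Q[OF x] unfolding Q_abs by (intro mult_left_mono) auto
      finally show ?thesis using t by simp
    qed
    then have "H (t, x) \<in> box (-1) 1"
      by (simp add: mem_box_cart abs_less_iff)
    then show "H (t, x) \<in> interior ?Q"
      unfolding Q by simp
  qed
  ultimately show ?thesis
    unfolding brick_def by blast
qed

end
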